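(* For $n\ge 1$ let $I_n=\{0,1,\dots,2^n-1\}$. Define vectors $\widehat\sigma_n=(\mu_0^{(n)},\mu_1^{(n)},\dots,\mu_{2^n-1}^{(n)})$ by $\widehat\sigma_1=(0,1)$ and, for $n\ge2$, $$\widehat\sigma_n=(\widehat\sigma_{n-1},\widehat\sigma_{n-1})+2^{n-1}\left(1-\nu_0^{(n)},\nu_0^{(n)},1-\nu_1^{(n)},\nu_1^{(n)},\dots,1-\nu_{2^{n-1}-1}^{(n)},\nu_{2^{n-1}-1}^{(n)}\right),$$ where the binary sequence $\nu^{(n)}=(\nu_0^{(n)},\dots,\nu_{2^{n-1}-1}^{(n)})\in\{0,1\}^{2^{n-1}}$ is $$\nu^{(n)}=\left(T_{g_1^{(n)}}\circ T_{g_2^{(n)}}\circ\cdots\circ T_{g_{n-1}^{(n)}}\right)(0).$$ Then $\widehat\sigma_n$ is a permutation vector of $I_n$, and the permutation matrix $\sigma_n$ determined by $\sigma_n e_j=e_{\mu_j^{(n)}}$ for all $j\in I_n$ satisfies, for every $n\ge1$, $$\sigma_n^*\,M_B^{(n)}\,\sigma_n=M_L^{(n)}.$$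
   Context: Notation: $(u,v)$ is the concatenation of vectors $u,v$. Rows and columns of $2^n\times2^n$ matrices are indexed by $I_n=\{0,\dots,2^n-1\}$, and $e_j$ ($j\in I_n$) is the standard basis column vector with $1$ in position $j$; $*$ denotes the transpose. Binary pattern of the Sierpinski gasket: $g_m^{(n)}\in\{0,1\}$, $1\le m\le n$, with $g_1^{(n)}=g_n^{(n)}=1$ and $g_m^{(n)}=g_{m-1}^{(n-1)}+g_m^{(n-1)}\bmod 2$ for $2\le m\le n-1$. Operators $T_\alpha$, $\alpha\in\{0,1\}$, on finite binary sequences: $T_0(s_1,\dots,s_m)=(s_1,\dots,s_m,s_1,\dots,s_m)$ and $T_1(s_1,\dots,s_m)=(s_1,\dots,s_m,1-s_1,\dots,1-s_m)$. Lamplighter matrices: $a_{L,0}^{(0)}=a_{L,1}^{(0)}=1$, $$a_{L,0}^{(n+1)}=\begin{pmatrix}0&a_{L,1}^{(n)}\\ a_{L,0}^{(n)}&0\end{pmatrix},\qquad a_{L,1}^{(n+1)}=\begin{pmatrix}a_{L,0}^{(n)}&0\\ 0&a_{L,1}^{(n)}\end{pmatrix}.$$ BBS translation (box-ball system with carrier capacity $1$) matrices: $a_{B,0}^{(0)}=a_{B,1}^{(0)}=1$, $$a_{B,0}^{(n+1)}=\begin{pmatrix}a_{B,0}^{(n)}&a_{B,1}^{(n)}\\ 0&0\end{pmatrix},\qquad a_{B,1}^{(n+1)}=\begin{pmatrix}0&0\\ a_{B,0}^{(n)}&a_{B,1}^{(n)}\end{pmatrix}.$$ The transition operators are taken here with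 integer entries (without the common normalizing factor $\frac14$): $M_L^{(n)}=\sum_{i=0}^1\left(a_{L,i}^{(n)}+a_{L,i}^{(n)*}\right)$ and $M_B^{(n)}=\sum_{i=0}^1\left(a_{B,i}^{(n)}+a_{B,i}^{(n)*}\right)$. *)

theory Defs
  imports
    "Jordan_Normal_Form.Matrix"
    "HOL-Combinatorics.Multiset_Permutations"
begin

text \<open>The binary Sierpinski pattern \<open>g\<^sub>m\<^sup>(\<^sup>n\<^sup>)\<close> is \<open>sierpinski n m\<close>. It is meaningful for
  \<open>1 \<le> m \<le> n\<close> only; the value \<open>0\<close> outside that range is never used.\<close>

fun sierpinski :: "nat \<Rightarrow> nat \<Rightarrow> nat" where
  "sierpinski n m =
    (if m < 1 \<or> n < m then 0
     else if m = 1 \<or> m = n then 1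
     else (sierpinski (n - 1) (m - 1) + sierpinski (n - 1) m) mod 2)"

declare sierpinski.simps [simp del]

text \<open>Binary sequences are lists over \<open>{0, 1}\<close>, on which the truncated \<open>1 - x\<close> is the
  usual complement. In the operator below, the first argument ranges over \<open>{0, 1}\<close>.\<close>

definition T_op :: "nat \<Rightarrow> nat list \<Rightarrow> nat list" where
  "T_op \<alpha> s = s @ (if \<alpha> = 0 then s else map (\<lambda>x. 1 - x) s)"

text \<open>The innermost (first applied) operator is the one with index \<open>n - 1\<close>.\<close>

definition nu :: "nat \<Rightarrow> nat list" where
  "nu n = foldr (\<lambda>m. T_op (sierpinski n m)) [1..<n] [0]"

text \<open>The entry \<open>\<mu>\<^sub>j\<^sup>(\<^sup>n\<^sup>)\<close> is \<open>sigma_hat n ! j\<close>. The vectors are defined for \<open>n \<ge> 1\<close>;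
  the value at \<open>0\<close> is a dummy on which the others do not depend.\<close>

fun sigma_hat :: "nat \<Rightarrow> nat list" where
  "sigma_hat 0 = []"
| "sigma_hat (Suc 0) = [0, 1]"
| "sigma_hat (Suc (Suc k)) =
    map2 (\<lambda>a b. a + 2 ^ Suc k * b)
      (sigma_hat (Suc k) @ sigma_hat (Suc k))
      (concat (map (\<lambda>v. [1 - v, v]) (nu (Suc (Suc k)))))"

definition sigma_mat :: "nat \<Rightarrow> int mat" where
  "sigma_mat n = mat_of_cols (2 ^ n) (map (\<lambda>j. unit_vec (2 ^ n) (sigma_hat n ! j)) [0..<2 ^ n])"

text \<open>\<open>sigma_mat n\<close> is the one matrix sending \<open>e\<^sub>j\<close> to \<open>e\<^bsub>\<mu>\<^sub>j\<^esub>\<close> for all \<open>j\<close>.\<close>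

lemma sigma_mat_iff:
  "S = sigma_mat n \<longleftrightarrow> S \<in> carrier_mat (2 ^ n) (2 ^ n) \<and>
     (\<forall>j<2 ^ n. S *\<^sub>v unit_vec (2 ^ n) j = unit_vec (2 ^ n) (sigma_hat n ! j))"
proof -
  have carr: "sigma_mat n \<in> carrier_mat (2 ^ n) (2 ^ n)"
    unfolding sigma_mat_def by (rule carrier_matI) simp_all
  have col: "col (sigma_mat n) j = unit_vec (2 ^ n) (sigma_hat n ! j)" if "j < 2 ^ n" for j
    using that unfolding sigma_mat_def by (subst col_mat_of_cols) auto
  have mult: "A *\<^sub>v unit_vec (2 ^ n) j = col A j"
    if "A \<in> carrier_mat (2 ^ n) (2 ^ n)" "j < 2 ^ n" for A :: "int mat" and j
    using that by (intro eq_vecI) auto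
  show ?thesis
  proof
    assume "S = sigma_mat n"
    then show "S \<in> carrier_mat (2 ^ n) (2 ^ n) \<and>
      (\<forall>j<2 ^ n. S *\<^sub>v unit_vec (2 ^ n) j = unit_vec (2 ^ n) (sigma_hat n ! j))"
      using carr col mult by simp
  next
    assume "S \<in> carrier_mat (2 ^ n) (2 ^ n) \<and>
      (\<forall>j<2 ^ n. S *\<^sub>v unit_vec (2 ^ n) j = unit_vec (2 ^ n) (sigma_hat n ! j))"
    then show "S = sigma_mat n"
      using carr col mult by (intro mat_col_eqI) auto
  qed
qed

fun aL0 :: "nat \<Rightarrow> int mat" and aL1 :: "nat \<Rightarrow> int mat" where
  "aL0 0 = 1\<^sub>m 1"
| "aL1 0 = 1\<^sub>m 1"
| "aL0 (Suc n) = four_block_mat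
     (0\<^sub>m (2 ^ n) (2 ^ n)) (aL1 n)
     (aL0 n) (0\<^sub>m (2 ^ n) (2 ^ n))"
| "aL1 (Suc n) = four_block_mat
     (aL0 n) (0\<^sub>m (2 ^ n) (2 ^ n))
     (0\<^sub>m (2 ^ n) (2 ^ n)) (aL1 n)"

fun aB0 :: "nat \<Rightarrow> int mat" and aB1 :: "nat \<Rightarrow> int mat" where
  "aB0 0 = 1\<^sub>m 1"
| "aB1 0 = 1\<^sub>m 1"
| "aB0 (Suc n) = four_block_mat
     (aB0 n) (aB1 n)
     (0\<^sub>m (2 ^ n) (2 ^ n)) (0\<^sub>m (2 ^ n) (2 ^ n))"
| "aB1 (Suc n) = four_block_mat
     (0\<^sub>m (2 ^ n) (2 ^ n)) (0\<^sub>m (2 ^ n) (2 ^ n))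
     (aB0 n) (aB1 n)"

definition M_L :: "nat \<Rightarrow> int mat" where
  "M_L n = (aL0 n + transpose_mat (aL0 n)) + (aL1 n + transpose_mat (aL1 n))"

definition M_B :: "nat \<Rightarrow> int mat" where
  "M_B n = (aB0 n + transpose_mat (aB0 n)) + (aB1 n + transpose_mat (aB1 n))"

end

theory Submission
  imports Defs
begin

text \<open>Both transition operators are adjacency matrices of undirected graphs, and in terms of
  binary digits the permutation is an affine map over the field with two elements that carries one
  graph to the other.

  Write \<open>j\<^sub>k\<close> for the digit of weight \<open>2 ^ k\<close> of \<open>j\<close>, and put \<open>N = n - 1\<close>. Unfolding the block
  recursions, \<open>a\<^sub>L\<^sub>,\<^sub>0 + a\<^sub>L\<^sub>,\<^sub>1\<close> has a \<open>1\<close> in position \<open>(r, j)\<close> exactly if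
  \<open>r\<^sub>k = j\<^sub>k + j\<^sub>k\<^sub>+\<^sub>1 + 1\<close> modulo \<open>2\<close> for all \<open>k < N\<close> (\<open>lamp_step\<close>), whereas \<open>a\<^sub>B\<^sub>,\<^sub>0 + a\<^sub>B\<^sub>,\<^sub>1\<close>
  has a \<open>1\<close> exactly if \<open>r\<^sub>k = j\<^sub>k\<^sub>+\<^sub>1\<close> for all \<open>k < N\<close> (\<open>shift_step\<close>, the de Bruijn graph).
  The top digit of \<open>r\<close> is free in both because it encodes the initial state, over which the matrices are summed.

  The Sierpinski pattern is Pascal's triangle modulo \<open>2\<close>, and every operator \<open>T\<^sub>\<alpha>\<close> adds \<open>\<alpha>\<close> times
  a new leading digit of the index. Hence the digit of weight \<open>2 ^ m\<close> of \<open>\<mu>\<^sub>j\<close> is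
  \<open>F\<^sub>m(j) = [m \<ge> 1] + (\<Sum>k\<le>m. (m choose k) * j\<^sub>k)\<close> modulo \<open>2\<close> (\<open>sigma_hat_digits\<close>). Two
  properties of \<open>F\<close> (\<open>gasket_digit\<close>) finish the proof.

  It is unitriangular: \<open>j\<^sub>m\<close> occurs in \<open>F\<^sub>m\<close> with coefficient \<open>1\<close> and the other digits that occur
  are lower. So the values of \<open>F\<close> determine the digits (\<open>gasket_digits_determine\<close>), which makes
  \<open>j \<mapsto> \<mu>\<^sub>j\<close> a permutation.

  By Pascal's rule, \<open>F\<^sub>m\<^sub>+\<^sub>1(j) = F\<^sub>m(x)\<close> where \<open>x\<^sub>k = j\<^sub>k + j\<^sub>k\<^sub>+\<^sub>1 + 1\<close> (\<open>gasket_digit_Suc\<close>).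
  So \<open>F\<^sub>m(r) = F\<^sub>m\<^sub>+\<^sub>1(j)\<close> for all \<open>m < N\<close> says that \<open>F\<close> agrees on \<open>r\<close> and \<open>x\<close> below \<open>N\<close>, which by
  unitriangularity means \<open>r\<^sub>k = x\<^sub>k\<close> for all \<open>k < N\<close>. Thus the permutation maps the directed
  lamplighter steps precisely to the directed shift steps (\<open>shift_step_sigma_hat\<close>). Adding the
  transposes and conjugating by the permutation matrix gives the claim.\<close>

section \<open>Binary digits of natural numbers\<close>

lemma bit_above:
  fixes x :: nat
  assumes "x < 2 ^ n" "n \<le> k"
  shows "\<not> bit x k"
proof -
  have "x < 2 ^ k"
    using assms by (meson less_le_trans one_le_numeral power_increasing)
  then show ?thesis by (simp add: bit_iff_odd)
qed

lemma bit_add_mult_power: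
  fixes x b :: nat
  assumes "x < 2 ^ n"
  shows "k < n \<Longrightarrow> bit (x + 2 ^ n * b) k = bit x k"
    and "bit (x + 2 ^ n * b) n = odd b"
proof -
  have *: "take_bit n (x + 2 ^ n * b) = x"
    using assms by (simp add: take_bit_eq_mod)
  show "bit (x + 2 ^ n * b) k = bit x k" if "k < n"
    using arg_cong[OF *, of "\<lambda>y. bit y k"] that by (simp add: bit_take_bit_iff)
  show "bit (x + 2 ^ n * b) n = odd b"
    using assms by (simp add: bit_iff_odd)
qed

lemma bit_power_plus:
  fixes x :: nat
  assumes "x < 2 ^ n"
  shows "bit (2 ^ n + x) k \<longleftrightarrow> k = n \<or> bit x k"
proof (cases k n rule: linorder_cases)
  case less
  then show ?thesis using bit_add_mult_power(1)[OF assms, of k 1] by (simp add: add.commute)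
next
  case equal
  then show ?thesis using bit_add_mult_power(2)[OF assms, of 1] by (simp add: add.commute)
next
  case greater
  moreover have "2 ^ n + x < 2 ^ Suc n" using assms by simp
  ultimately show ?thesis
    using bit_above[of "2 ^ n + x" "Suc n" k] bit_above[OF assms, of k] by simp
qed

lemma bit_power_plus_Suc:
  fixes x :: nat
  assumes "x < 2 ^ n"
  shows "bit (2 ^ Suc n + x) k \<longleftrightarrow> k = Suc n \<or> bit x k"
    and "bit (2 ^ Suc n + (2 ^ n + x)) k \<longleftrightarrow> k = Suc n \<or> k = n \<or> bit x k"
proof -
  have "x < 2 ^ Suc n" "2 ^ n + x < 2 ^ Suc n" using assms by simp_all
  then show "bit (2 ^ Suc n + x) k \<longleftrightarrow> k = Suc n \<or> bit x k"
    and "bit (2 ^ Suc n + (2 ^ n + x)) k \<longleftrightarrow> k = Suc n \<or> k = n \<or> bit x k"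
    using bit_power_plus[of _ "Suc n" k] bit_power_plus[OF assms, of k] by blast+
qed

lemma eq_by_low_bits:
  fixes x y :: nat
  assumes "x < 2 ^ n" "y < 2 ^ n" "\<And>k. k < n \<Longrightarrow> bit x k = bit y k"
  shows "x = y"
  using assms bit_above[of x n] bit_above[of y n] by (metis bit_eqI not_less)

section \<open>The binomial transform modulo two\<close>

definition bin_parity :: "nat \<Rightarrow> (nat \<Rightarrow> bool) \<Rightarrow> bool" where
  "bin_parity m f \<longleftrightarrow> odd (\<Sum>k\<le>m. (m choose k) * of_bool (f k))"

text \<open>The added constant is \<open>1\<close> in every row but row \<open>0\<close>: row \<open>m\<close> of Pascal's triangle has sum
  \<open>2 ^ m\<close>, so \<open>m = 0\<close> is the only row in which the constant of the lamplighter rule survives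
  the summation modulo \<open>2\<close>.\<close>

definition gasket_digit :: "nat \<Rightarrow> (nat \<Rightarrow> bool) \<Rightarrow> bool" where
  "gasket_digit m f \<longleftrightarrow> (m \<ge> 1) \<noteq> bin_parity m f"

lemma gasket_digit_cong:
  assumes "\<And>k. k \<le> m \<Longrightarrow> f k = g k"
  shows "gasket_digit m f = gasket_digit m g"
  unfolding gasket_digit_def bin_parity_def using assms by simp

text \<open>Pascal's rule, summed against a weight: the row \<open>m + 1\<close> acts on \<open>h\<close> as the row \<open>m\<close> acts on
  the sums of neighbours.\<close>

lemma sum_binomial_Suc:
  fixes h :: "nat \<Rightarrow> nat"
  shows "(\<Sum>k\<le>Suc m. (Suc m choose k) * h k) = (\<Sum>k\<le>m. (m choose k) * (h k + h (Suc k)))"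
proof -
  have "(\<Sum>k\<le>Suc m. (Suc m choose k) * h k)
      = h 0 + (\<Sum>k\<le>m. (m choose Suc k) * h (Suc k)) + (\<Sum>k\<le>m. (m choose k) * h (Suc k))"
    by (subst sum.atMost_Suc_shift) (simp add: sum.distrib add_mult_distrib)
  also have "h 0 + (\<Sum>k\<le>m. (m choose Suc k) * h (Suc k)) = (\<Sum>k\<le>Suc m. (m choose k) * h k)"
    by (subst sum.atMost_Suc_shift) simp
  finally show ?thesis by (simp add: sum.distrib add_mult_distrib2)
qed

text \<open>For Boolean digits, \<open>f k = f (Suc k)\<close> is the sum of the two neighbours plus \<open>1\<close>. This is the
  identity that turns the lamplighter rule into a shift of the digit position.\<close>

lemma gasket_digit_Suc:
  "gasket_digit (Suc m) f = gasket_digit m (\<lambda>k. f k = f (Suc k))"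
proof -
  let ?b = "\<lambda>k. of_bool (f k) :: nat"
  let ?S = "\<lambda>h. \<Sum>k\<le>m. (m choose k) * (h k :: nat)"
  let ?x = "\<lambda>k. of_bool (f k = f (Suc k)) :: nat"
  have even_sum: "even (?S (\<lambda>k. ?b k + ?b (Suc k)) + ?S ?x + ?S (\<lambda>k. 1))"
    unfolding sum.distrib[symmetric] add_mult_distrib2[symmetric]
    by (intro dvd_sum) simp
  have pow: "?S (\<lambda>k. 1) = 2 ^ m" by (simp add: choose_row_sum)
  have parity: "odd a \<noteq> odd b \<longleftrightarrow> m = 0" if "even (a + b + 2 ^ m)" for a b :: nat
    using that by (cases m) auto
  have "odd (?S (\<lambda>k. ?b k + ?b (Suc k))) \<noteq> odd (?S ?x) \<longleftrightarrow> m = 0"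
    using even_sum unfolding pow by (rule parity)
  then show ?thesis
    unfolding gasket_digit_def bin_parity_def sum_binomial_Suc by linarith
qed

text \<open>The coefficient of \<open>f m\<close> in row \<open>m\<close> is \<open>m choose m = 1\<close>, so the system is solved from the
  lowest digit upwards.\<close>

lemma gasket_digits_determine:
  assumes "\<And>m. m < n \<Longrightarrow> gasket_digit m f = gasket_digit m g" "k < n"
  shows "f k = g k"
  using \<open>k < n\<close>
proof (induction k rule: less_induct)
  case (less k)
  have "(\<Sum>i<k. (k choose i) * (of_bool (f i) :: nat)) = (\<Sum>i<k. (k choose i) * of_bool (g i))"
    using less by (intro sum.cong) auto
  moreover have "bin_parity k f = bin_parity k g"
    using assms(1)[OF less.prems] by (auto simp: gasket_digit_def)
  ultimately show ?case
    by (auto simp: bin_parity_def lessThan_Suc_atMost[symmetric] split: if_splits)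
qed

section \<open>The digits of the permutation\<close>

lemma sierpinski_eq_binomial:
  "k \<le> n \<Longrightarrow> sierpinski (Suc n) (Suc k) = (n choose k) mod 2"
proof (induction n arbitrary: k)
  case 0
  then show ?case by (simp add: sierpinski.simps)
next
  case (Suc n)
  show ?case
  proof (cases "k = 0 \<or> k = Suc n")
    case True
    then show ?thesis by (auto simp: sierpinski.simps)
  next
    case False
    then obtain i where i: "k = Suc i" "Suc i \<le> n" using Suc.prems by (cases k) auto
    have "sierpinski (Suc (Suc n)) (Suc k)
        = (sierpinski (Suc n) (Suc i) + sierpinski (Suc n) (Suc k)) mod 2"
      using i by (subst sierpinski.simps) auto
    then show ?thesis using i Suc.IH[of i] Suc.IH[of k] by (simp add: mod_simps)
  qed
qed

lemma length_foldr_T_op: "length (foldr T_op gs [0]) = 2 ^ length gs"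
  by (induction gs) (auto simp: T_op_def)

lemma foldr_T_op_le_1: "x \<in> set (foldr T_op gs [0]) \<Longrightarrow> x \<le> 1"
  by (induction gs arbitrary: x) (auto simp: T_op_def split: if_splits)

text \<open>The outermost operator doubles last and therefore governs the leading digit of the index,
  which is why the list of operators is reversed. Complementing the second half adds \<open>1\<close> modulo
  \<open>2\<close> exactly where that digit is set.\<close>

lemma foldr_T_op_nth:
  assumes "set gs \<subseteq> {0, 1}" "i < 2 ^ length gs"
  shows "odd (foldr T_op gs [0] ! i)
    \<longleftrightarrow> odd (\<Sum>k<length gs. rev gs ! k * of_bool (bit i k))"
  using assms
proof (induction gs arbitrary: i)
  case Nil
  then show ?case by simp
next
  case (Cons a gs)
  let ?p = "length gs"
  let ?s = "foldr T_op gs [0]"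
  have a: "a = 0 \<or> a = 1" using Cons.prems(1) by simp
  show ?case
  proof (cases "i < 2 ^ ?p")
    case True
    have "T_op a ?s ! i = ?s ! i"
      using True by (simp add: T_op_def nth_append length_foldr_T_op)
    then show ?thesis
      using Cons True bit_above[OF True] by (simp add: nth_append)
  next
    case False
    then obtain i' where i: "i = 2 ^ ?p + i'" "i' < 2 ^ ?p"
      using Cons.prems(2) by (metis add_less_cancel_left le_Suc_ex length_Cons mult_2 not_less power_Suc)
    have le: "?s ! i' \<le> 1" using i(2) by (intro foldr_T_op_le_1[of _ gs] nth_mem) (simp add: length_foldr_T_op)
    have "odd (T_op a ?s ! i) \<longleftrightarrow> odd (?s ! i' + a)"
      using i a le by (auto simp: T_op_def nth_append length_foldr_T_op)
    moreover have "odd (?s ! i') \<longleftrightarrow> odd (\<Sum>k<?p. rev gs ! k * of_bool (bit i' k))"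
      using Cons i by simp
    ultimately show ?thesis
      using i by (simp add: nth_append bit_power_plus)
  qed
qed

lemma nu_eq_foldr: "nu n = foldr T_op (map (sierpinski n) [1..<n]) [0]"
  by (simp add: nu_def foldr_map comp_def)

lemma sierpinski_binary: "sierpinski n m \<in> {0, 1}"
  by (subst sierpinski.simps) (auto simp: mod2_eq_if)

lemma length_nu: "length (nu (Suc n)) = 2 ^ n"
  by (simp add: nu_eq_foldr length_foldr_T_op)

lemma nu_le_1: "i < 2 ^ n \<Longrightarrow> nu (Suc n) ! i \<le> 1"
  by (metis foldr_T_op_le_1 length_nu nth_mem nu_eq_foldr)

text \<open>The digit \<open>k\<close> of \<open>i\<close> is governed by the Sierpinski entry \<open>n - k\<close> in row \<open>n + 1\<close>, that is, by
  \<open>n choose (n - k - 1) = n choose (k + 1)\<close>.\<close>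

lemma odd_nu_nth:
  assumes "i < 2 ^ n"
  shows "odd (nu (Suc n) ! i) \<longleftrightarrow> odd (\<Sum>k<n. (n choose Suc k) * of_bool (bit i k))"
proof -
  let ?gs = "map (sierpinski (Suc n)) [1..<Suc n]"
  have gs: "rev ?gs ! k = (n choose Suc k) mod 2" if k: "k < n" for k
  proof -
    have "rev ?gs ! k = sierpinski (Suc n) (Suc (n - Suc k))"
      using k by (simp add: rev_nth del: upt_Suc)
    also have "\<dots> = (n choose (n - Suc k)) mod 2"
      by (rule sierpinski_eq_binomial) simp
    finally show ?thesis using k binomial_symmetric[of "Suc k" n] by simp
  qed
  have mod2: "odd (\<Sum>k<p. c k mod 2 * h k) \<longleftrightarrow> odd (\<Sum>k<p. c k * h k)"
    for p :: nat and c h :: "nat \<Rightarrow> nat"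
    by (induction p) auto
  have len: "length ?gs = n" by (simp del: upt_Suc)
  have binary: "set ?gs \<subseteq> {0, 1}"
    unfolding set_map using sierpinski_binary by (rule image_subsetI)
  have "odd (nu (Suc n) ! i) \<longleftrightarrow> odd (\<Sum>k<n. rev ?gs ! k * of_bool (bit i k))"
    using foldr_T_op_nth[OF binary, unfolded len, OF assms] unfolding nu_eq_foldr .
  also have "(\<Sum>k<n. rev ?gs ! k * of_bool (bit i k))
      = (\<Sum>k<n. (n choose Suc k) mod 2 * of_bool (bit i k))"
    using gs by (intro sum.cong) auto
  also have "odd \<dots> \<longleftrightarrow> odd (\<Sum>k<n. (n choose Suc k) * of_bool (bit i k))"
    by (rule mod2)
  finally show ?thesis .
qed

lemma nth_concat_pairs:
  "j < 2 * length xs \<Longrightarrow>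
    concat (map (\<lambda>v. [f v, g v]) xs) ! j = (if even j then f else g) (xs ! (j div 2))"
proof (induction xs arbitrary: j)
  case (Cons x xs)
  show ?case
  proof (cases "j < 2")
    case True
    then show ?thesis by (cases "j = 0") (auto simp: less_Suc_eq numeral_2_eq_2)
  next
    case False
    then obtain i where "j = Suc (Suc i)" by (metis add_2_eq_Suc le_Suc_ex not_less)
    then show ?thesis using Cons by auto
  qed
qed simp

lemma length_concat_pairs: "length (concat (map (\<lambda>v. [f v, g v]) xs)) = 2 * length xs"
  by (induction xs) auto

lemma length_sigma_hat: "length (sigma_hat (Suc n)) = 2 ^ Suc n"
  by (induction n) (simp_all add: length_concat_pairs length_nu)

text \<open>The sequence \<open>\<nu>\<close> adds one leading digit to the value at
  \<open>j mod 2 ^ Suc n\<close>. In \<open>\<nu>\<close> the index is \<open>j div 2\<close>, so its formula involves the digits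
  \<open>j\<^sub>1, j\<^sub>2, \<dots>\<close> with the coefficients of index \<open>k + 1\<close>; the pairs \<open>(1 - v, v)\<close> supply the
  missing term \<open>j\<^sub>0\<close> and the constant \<open>1\<close>.\<close>

lemma sigma_hat_nth_Suc:
  assumes j: "j < 2 ^ Suc (Suc n)"
  shows "sigma_hat (Suc (Suc n)) ! j = sigma_hat (Suc n) ! (j mod 2 ^ Suc n)
    + 2 ^ Suc n * of_bool (gasket_digit (Suc n) (bit j))"
proof -
  let ?N = "Suc n"
  let ?b = "concat (map (\<lambda>v. [1 - v, v]) (nu (Suc ?N))) ! j"
  define v where "v = nu (Suc ?N) ! (j div 2)"
  have half: "j div 2 < 2 ^ ?N" using j by simp
  have low: "(sigma_hat ?N @ sigma_hat ?N) ! j = sigma_hat ?N ! (j mod 2 ^ ?N)"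
  proof (cases "j < 2 ^ ?N")
    case True
    then show ?thesis by (simp only: nth_append length_sigma_hat if_True mod_less)
  next
    case False
    moreover have "j mod 2 ^ ?N = j - 2 ^ ?N"
      using False j by (subst le_mod_geq) auto
    ultimately show ?thesis by (simp only: nth_append length_sigma_hat if_False)
  qed
  have "sigma_hat (Suc ?N) ! j = sigma_hat ?N ! (j mod 2 ^ ?N) + 2 ^ ?N * ?b"
    unfolding sigma_hat.simps low[symmetric] using j
    by (subst nth_map) (auto simp: length_sigma_hat length_concat_pairs length_nu)
  moreover have "?b = (if even j then 1 - v else v)"
    unfolding v_def using j by (subst nth_concat_pairs) (simp_all add: length_nu)
  moreover have "v \<le> 1" unfolding v_def using half by (rule nu_le_1)
  moreover have "bin_parity ?N (bit j) \<longleftrightarrow> odd j \<noteq> odd v"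
    unfolding v_def odd_nu_nth[OF half] bin_parity_def lessThan_Suc_atMost[symmetric]
    by (subst sum.lessThan_Suc_shift) (auto simp: bit_0 bit_Suc)
  ultimately show ?thesis
    by (auto simp: gasket_digit_def le_Suc_eq)
qed

text \<open>Digit \<open>m\<close> first appears in \<open>sigma_hat (Suc m)\<close>. The later stages leave it alone, and
  replacing \<open>j\<close> by its residue is harmless because only the digits of \<open>j\<close> up to \<open>m\<close> enter.\<close>

lemma sigma_hat_digits:
  assumes "j < 2 ^ Suc n"
  shows "sigma_hat (Suc n) ! j < 2 ^ Suc n"
    and "m < Suc n \<Longrightarrow> bit (sigma_hat (Suc n) ! j) m = gasket_digit m (bit j)"
  using assms
proof (induction n arbitrary: j m)
  case 0
  case 1
  then show ?case by (auto simp: less_Suc_eq numeral_2_eq_2)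
  case 2
  then show ?case
    by (auto simp: less_Suc_eq numeral_2_eq_2 gasket_digit_def bin_parity_def
        bit_0 Int_insert_left)
next
  case (Suc n)
  have low: "sigma_hat (Suc n) ! (j mod 2 ^ Suc n) < 2 ^ Suc n" for j
    by (rule Suc.IH(1)) simp
  { case 1
    have "sigma_hat (Suc n) ! (j mod 2 ^ Suc n) + 2 ^ Suc n * of_bool (gasket_digit (Suc n) (bit j))
        < 2 ^ Suc (Suc n)"
      using low[of j] by auto
    then show ?case unfolding sigma_hat_nth_Suc[OF 1] . }
  { case 2
    show ?case
    proof (cases "m = Suc n")
      case True
      then show ?thesis
        unfolding sigma_hat_nth_Suc[OF 2(2)] using bit_add_mult_power(2)[OF low] by simp
    next
      case False
      then have m: "m < Suc n" using 2(1) by simp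
      have "bit (sigma_hat (Suc (Suc n)) ! j) m = bit (sigma_hat (Suc n) ! (j mod 2 ^ Suc n)) m"
        unfolding sigma_hat_nth_Suc[OF 2(2)] using bit_add_mult_power(1)[OF low m] .
      also have "\<dots> = gasket_digit m (bit (j mod 2 ^ Suc n))"
        by (rule Suc.IH(2)[OF m]) simp
      also have "\<dots> = gasket_digit m (bit j)"
        using m by (intro gasket_digit_cong)
          (auto simp: take_bit_eq_mod[symmetric] bit_take_bit_iff simp del: power_Suc)
      finally show ?thesis .
    qed }
qed

lemma sigma_hat_permutation:
  "sigma_hat (Suc n) \<in> permutations_of_set {0..<2 ^ Suc n}"
proof -
  let ?xs = "sigma_hat (Suc n)"
  have "distinct ?xs"
    unfolding distinct_conv_nth length_sigma_hat
  proof (intro allI impI notI)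
    fix i j
    assume ij: "i < 2 ^ Suc n" "j < 2 ^ Suc n" "i \<noteq> j" "?xs ! i = ?xs ! j"
    have "bit i k = bit j k" if "k < Suc n" for k
    proof (rule gasket_digits_determine[OF _ that])
      show "gasket_digit m (bit i) = gasket_digit m (bit j)" if "m < Suc n" for m
        using sigma_hat_digits(2)[OF ij(1) that] sigma_hat_digits(2)[OF ij(2) that] ij(4) by simp
    qed
    then show False using eq_by_low_bits ij by blast
  qed
  moreover have "set ?xs \<subseteq> {0..<2 ^ Suc n}"
    using sigma_hat_digits(1) by (auto simp: in_set_conv_nth length_sigma_hat)
  ultimately show ?thesis
    by (intro permutations_of_setI card_subset_eq) (auto simp: distinct_card length_sigma_hat)
qed

section \<open>The two automata as digit conditions\<close>

text \<open>In both step relations the argument \<open>j\<close> may carry an extra digit in position \<open>n\<close>, above the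
  \<open>n\<close> digits of a column index. It stores the state of the automaton: after a block has been chosen,
  the next state is the leading digit of the column, so the state always behaves like one more
  column digit. For the sum over both states the relations are used with \<open>n\<close> one smaller than the
  number of digits.\<close>

definition lamp_step :: "nat \<Rightarrow> nat \<Rightarrow> nat \<Rightarrow> bool" where
  "lamp_step n r j \<longleftrightarrow> (\<forall>k<n. bit r k = (bit j k = bit j (Suc k)))"

definition shift_step :: "nat \<Rightarrow> nat \<Rightarrow> nat \<Rightarrow> bool" where
  "shift_step n r j \<longleftrightarrow> (\<forall>k<n. bit r k = bit j (Suc k))"

lemma aL_carrier [simp]:
  "aL0 n \<in> carrier_mat (2 ^ n) (2 ^ n)" "aL1 n \<in> carrier_mat (2 ^ n) (2 ^ n)"
  by (induction n) (simp_all add: mult_2)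

lemma aB_carrier [simp]:
  "aB0 n \<in> carrier_mat (2 ^ n) (2 ^ n)" "aB1 n \<in> carrier_mat (2 ^ n) (2 ^ n)"
  by (induction n) (simp_all add: mult_2)

lemma less_power_Suc_cases:
  assumes "(x::nat) < 2 ^ Suc n"
  obtains "x < 2 ^ n" | y where "x = 2 ^ n + y" "y < 2 ^ n"
  using assms by (metis add_less_cancel_left le_Suc_ex mult_2 not_less power_Suc)

lemma aL_entry:
  assumes "r < 2 ^ n" "j < 2 ^ n"
  shows "aL0 n $$ (r, j) = of_bool (lamp_step n r j)"
    and "aL1 n $$ (r, j) = of_bool (lamp_step n r (2 ^ n + j))"
  using assms
proof (induction n arbitrary: r j)
  case 0
  { case 1 then show ?case by (simp add: lamp_step_def) }
  { case 2 then show ?case by (simp add: lamp_step_def) }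
next
  case (Suc n)
  note dims = carrier_matD[OF aL_carrier(1)[of n]] carrier_matD[OF aL_carrier(2)[of n]]
  note bits = bit_power_plus bit_power_plus_Suc bit_above
  { case 1
    show ?case
      using 1 by (elim less_power_Suc_cases)
        (auto simp: Suc.IH dims lamp_step_def less_Suc_eq bits simp del: power_Suc) }
  { case 2
    show ?case
      using 2 by (elim less_power_Suc_cases)
        (auto simp: Suc.IH dims lamp_step_def less_Suc_eq bits simp del: power_Suc) }
qed

lemma aB_entry:
  assumes "r < 2 ^ n" "j < 2 ^ n"
  shows "aB0 n $$ (r, j) = of_bool (shift_step n r j)"
    and "aB1 n $$ (r, j) = of_bool (shift_step n r (2 ^ n + j))"
  using assms
proof (induction n arbitrary: r j)
  case 0
  { case 1 then show ?case by (simp add: shift_step_def) }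
  { case 2 then show ?case by (simp add: shift_step_def) }
next
  case (Suc n)
  note dims = carrier_matD[OF aB_carrier(1)[of n]] carrier_matD[OF aB_carrier(2)[of n]]
  note bits = bit_power_plus bit_power_plus_Suc bit_above
  { case 1
    show ?case
      using 1 by (elim less_power_Suc_cases)
        (auto simp: Suc.IH dims shift_step_def less_Suc_eq bits simp del: power_Suc) }
  { case 2
    show ?case
      using 2 by (elim less_power_Suc_cases)
        (auto simp: Suc.IH dims shift_step_def less_Suc_eq bits simp del: power_Suc) }
qed

text \<open>Exactly one of the two states satisfies the condition on the leading digit of \<open>r\<close>; summing
  over the states thus removes this condition.\<close>

lemma aL_sum_entry:
  assumes "r < 2 ^ Suc n" "j < 2 ^ Suc n"
  shows "aL0 (Suc n) $$ (r, j) + aL1 (Suc n) $$ (r, j) = of_bool (lamp_step n r j)"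
  unfolding aL_entry[OF assms] lamp_step_def
  using assms(2) by (auto simp del: power_Suc simp: bit_power_plus bit_above less_Suc_eq)

lemma aB_sum_entry:
  assumes "r < 2 ^ Suc n" "j < 2 ^ Suc n"
  shows "aB0 (Suc n) $$ (r, j) + aB1 (Suc n) $$ (r, j) = of_bool (shift_step n r j)"
  unfolding aB_entry[OF assms] shift_step_def
  using assms(2) by (auto simp del: power_Suc simp: bit_power_plus bit_above less_Suc_eq)

lemma M_L_entry:
  assumes "r < 2 ^ Suc n" "j < 2 ^ Suc n"
  shows "M_L (Suc n) $$ (r, j) = of_bool (lamp_step n r j) + of_bool (lamp_step n j r)"
proof -
  have "M_L (Suc n) $$ (r, j) = (aL0 (Suc n) $$ (r, j) + aL1 (Suc n) $$ (r, j))
      + (aL0 (Suc n) $$ (j, r) + aL1 (Suc n) $$ (j, r))"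
    unfolding M_L_def using assms carrier_matD[OF aL_carrier(1)[of "Suc n"]]
      carrier_matD[OF aL_carrier(2)[of "Suc n"]]
    by (simp del: aL0.simps aL1.simps)
  then show ?thesis by (simp only: aL_sum_entry assms)
qed

lemma M_B_entry:
  assumes "r < 2 ^ Suc n" "j < 2 ^ Suc n"
  shows "M_B (Suc n) $$ (r, j) = of_bool (shift_step n r j) + of_bool (shift_step n j r)"
proof -
  have "M_B (Suc n) $$ (r, j) = (aB0 (Suc n) $$ (r, j) + aB1 (Suc n) $$ (r, j))
      + (aB0 (Suc n) $$ (j, r) + aB1 (Suc n) $$ (j, r))"
    unfolding M_B_def using assms carrier_matD[OF aB_carrier(1)[of "Suc n"]]
      carrier_matD[OF aB_carrier(2)[of "Suc n"]]
    by (simp del: aB0.simps aB1.simps)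
  then show ?thesis by (simp only: aB_sum_entry assms)
qed

section \<open>The permutation intertwines the two automata\<close>

text \<open>A shift step compares digit \<open>m\<close> of one value with digit \<open>m + 1\<close> of the other, and
  \<open>gasket_digit_Suc\<close> lowers the latter to position \<open>m\<close> at the price of replacing the digits of \<open>j\<close>
  by those that the lamplighter rule prescribes for \<open>r\<close>.\<close>

lemma shift_step_sigma_hat:
  assumes "r < 2 ^ Suc n" "j < 2 ^ Suc n"
  shows "shift_step n (sigma_hat (Suc n) ! r) (sigma_hat (Suc n) ! j) \<longleftrightarrow> lamp_step n r j"
proof -
  let ?x = "\<lambda>k. bit j k = bit j (Suc k)"
  have "shift_step n (sigma_hat (Suc n) ! r) (sigma_hat (Suc n) ! j)
      \<longleftrightarrow> (\<forall>m<n. gasket_digit m (bit r) = gasket_digit m ?x)"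
    unfolding shift_step_def using assms
    by (simp add: sigma_hat_digits(2) gasket_digit_Suc del: power_Suc)
  also have "\<dots> \<longleftrightarrow> (\<forall>k<n. bit r k = ?x k)"
    using gasket_digits_determine[of n "bit r" ?x] gasket_digit_cong[of _ "bit r" ?x] by auto
  finally show ?thesis unfolding lamp_step_def .
qed

lemma sigma_mat_conjugate_entry:
  assumes X: "X \<in> carrier_mat (2 ^ n) (2 ^ n)"
    and r: "r < 2 ^ n" "sigma_hat n ! r < 2 ^ n" and j: "j < 2 ^ n" "sigma_hat n ! j < 2 ^ n"
  shows "(transpose_mat (sigma_mat n) * X * sigma_mat n) $$ (r, j)
    = X $$ (sigma_hat n ! r, sigma_hat n ! j)"
proof -
  let ?S = "sigma_mat n"
  have S: "?S \<in> carrier_mat (2 ^ n) (2 ^ n)"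
    unfolding sigma_mat_def by (rule carrier_matI) simp_all
  have col: "col ?S i = unit_vec (2 ^ n) (sigma_hat n ! i)" if "i < 2 ^ n" for i
    using that unfolding sigma_mat_def by (subst col_mat_of_cols) auto
  have SX: "transpose_mat ?S * X \<in> carrier_mat (2 ^ n) (2 ^ n)" using S X by simp
  have "(transpose_mat ?S * X * ?S) $$ (r, j) = row (transpose_mat ?S * X) r \<bullet> col ?S j"
    using S SX r j by (subst index_mult_mat) auto
  also have "\<dots> = (transpose_mat ?S * X) $$ (r, sigma_hat n ! j)"
    using SX r j unfolding col[OF j(1)]
    by (subst scalar_prod_right_unit[where n = "2 ^ n"]) (auto simp del: index_mult_mat)
  also have "\<dots> = col ?S r \<bullet> col X (sigma_hat n ! j)"
    using S X r j by (subst index_mult_mat) auto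
  also have "\<dots> = X $$ (sigma_hat n ! r, sigma_hat n ! j)"
    using X r j unfolding col[OF r(1)]
    by (subst scalar_prod_left_unit[where n = "2 ^ n"]) auto
  finally show ?thesis .
qed

theorem theorem6p1:
  fixes n :: nat
  assumes "n \<ge> 1"
  shows "sigma_hat n \<in> permutations_of_set {0..<2 ^ n} \<and>
    transpose_mat (sigma_mat n) * M_B n * sigma_mat n = M_L n"
proof
  obtain N where n: "n = Suc N" using assms by (cases n) auto
  show "sigma_hat n \<in> permutations_of_set {0..<2 ^ n}"
    unfolding n by (rule sigma_hat_permutation)
  have B: "M_B n \<in> carrier_mat (2 ^ n) (2 ^ n)" and L: "M_L n \<in> carrier_mat (2 ^ n) (2 ^ n)"
    unfolding M_B_def M_L_def by (simp_all only: add_carrier_mat transpose_carrier_mat aL_carrier aB_carrier)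
  have S: "sigma_mat n \<in> carrier_mat (2 ^ n) (2 ^ n)"
    unfolding sigma_mat_def by (rule carrier_matI) simp_all
  show "transpose_mat (sigma_mat n) * M_B n * sigma_mat n = M_L n"
  proof (rule eq_matI)
    fix r j
    assume "r < dim_row (M_L n)" "j < dim_col (M_L n)"
    then have rj: "r < 2 ^ Suc N" "j < 2 ^ Suc N" using L n by auto
    have "(transpose_mat (sigma_mat n) * M_B n * sigma_mat n) $$ (r, j)
        = M_B n $$ (sigma_hat n ! r, sigma_hat n ! j)"
      using B rj sigma_hat_digits(1) unfolding n by (intro sigma_mat_conjugate_entry) auto
    also have "\<dots> = M_L n $$ (r, j)"
      unfolding n using rj
      by (simp only: M_B_entry M_L_entry sigma_hat_digits(1) shift_step_sigma_hat)
    finally show "(transpose_mat (sigma_mat n) * M_B n * sigma_mat n) $$ (r, j) = M_L n $$ (r, j)" .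
  qed (use S B L in auto)
qed

end
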